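(* Let $Q\in\mathrm{Gr}(k,n)$ with $Q=VI_{k,n-k}V^{\mathsf T}$, $V\in\mathrm{O}(n)$. The normal space of $\mathrm{Gr}(k,n)$ at $Q$, as a submanifold of $\mathrm{O}(n)$, is \[ \mathbb{N}_Q\mathrm{Gr}(k,n)=\left\{V\begin{bmatrix}\Lambda_1&0\\0&\Lambda_2\end{bmatrix}V^{\mathsf T}:\ \Lambda_1\in\mathbb{R}^{k\times k},\ \Lambda_2\in\mathbb{R}^{(n-k)\times(n-k)},\ \Lambda_1^{\mathsf T}=-\Lambda_1,\ \Lambda_2^{\mathsf T}=-\Lambda_2\right\}. \]
   Context: For $k\in\{1,\dots,n\}$, $\mathrm{Gr}(k,n)=\{Q\in\mathrm{O}(n):Q^{\mathsf T}=Q,\ \operatorname{tr}(Q)=2k-n\}$, an embedded submanifold of $\mathrm{O}(n)$; $I_{k,n-k}=\operatorname{diag}(I_k,-I_{n-k})$; every $Q\in\mathrm{Gr}(k,n)$ can be written $Q=VI_{k,n-k}V^{\mathsf T}$ with $V\in\mathrm{O}(n)$. $\mathrm{O}(n)$ carries the Riemannian metric $g_Q(X,Y)=\operatorname{tr}(X^{\mathsf T}Y)$ on $\mathbb{T}_Q\mathrm{O}(n)=\{Q\Lambda:\Lambda\in\mathbb{R}^{n\times n},\ \Lambda^{\mathsf T}=-\Lambda\}$. The normal space $\mathbb{N}_Q\mathrm{Gr}(k,n)$ is the orthogonal complement of $\mathbb{T}_Q\mathrm{Gr}(k,n)$ in $\mathbb{T}_Q\mathrm{O}(n)$ with respect to this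 metric. *)

theory Defs
  imports "HOL-Analysis.Derivative" "Jordan_Normal_Form.Matrix"
begin

definition mtrace :: "real mat \<Rightarrow> real" where
  "mtrace A = (\<Sum>i<dim_row A. A $$ (i, i))"

definition O_group :: "nat \<Rightarrow> real mat set" where
  "O_group n = {Q \<in> carrier_mat n n. transpose_mat Q * Q = 1\<^sub>m n}"

definition skew_mats :: "nat \<Rightarrow> real mat set" where
  "skew_mats n = {\<Lambda> \<in> carrier_mat n n. transpose_mat \<Lambda> = - \<Lambda>}"

definition Gr :: "nat \<Rightarrow> nat \<Rightarrow> real mat set" where
  "Gr k n = {Q \<in> O_group n. transpose_mat Q = Q \<and> mtrace Q = 2 * real k - real n}"

definition block_diag :: "real mat \<Rightarrow> real mat \<Rightarrow> real mat" where
  "block_diag A B =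
     four_block_mat A (0\<^sub>m (dim_row A) (dim_col B)) (0\<^sub>m (dim_row B) (dim_col A)) B"

definition I_sig :: "nat \<Rightarrow> nat \<Rightarrow> real mat" where
  "I_sig k l = block_diag (1\<^sub>m k) (- 1\<^sub>m l)"

definition smooth_real_on :: "real set \<Rightarrow> (real \<Rightarrow> real) \<Rightarrow> bool" where
  "smooth_real_on S f \<longleftrightarrow> (\<forall>m. \<forall>t\<in>S. (deriv ^^ m) f field_differentiable (at t))"

text \<open>
  The tangent space at \<open>Q\<close> of an embedded submanifold \<open>M\<close> of \<open>n \<times> n\<close> real matrices, as the set of
  initial velocities of smooth curves in \<open>M\<close> through \<open>Q\<close>.  The type \<open>real mat\<close> carries no topology,
  so smoothness and derivatives of a curve are taken entrywise.
\<close>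

definition tangent_space :: "nat \<Rightarrow> real mat set \<Rightarrow> real mat \<Rightarrow> real mat set" where
  "tangent_space n M Q =
     {X \<in> carrier_mat n n. \<exists>(\<gamma> :: real \<Rightarrow> real mat) \<epsilon>. \<epsilon> > 0 \<and>
        (\<forall>t\<in>{-\<epsilon><..<\<epsilon>}. \<gamma> t \<in> M) \<and> \<gamma> 0 = Q \<and>
        (\<forall>i<n. \<forall>j<n. smooth_real_on {-\<epsilon><..<\<epsilon>} (\<lambda>t. \<gamma> t $$ (i, j)) \<and>
           ((\<lambda>t. \<gamma> t $$ (i, j)) has_real_derivative X $$ (i, j)) (at 0))}"

text \<open>
  The tangent space of the orthogonal group in its explicit description, and the Riemannian metric
  on it.  The value of the metric does not depend on the base point \<open>Q\<close>.
\<close>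

definition tangent_O :: "nat \<Rightarrow> real mat \<Rightarrow> real mat set" where
  "tangent_O n Q = {Q * \<Lambda> |\<Lambda>. \<Lambda> \<in> skew_mats n}"

definition metric_O :: "real mat \<Rightarrow> real mat \<Rightarrow> real mat \<Rightarrow> real" where
  "metric_O Q X Y = mtrace (transpose_mat X * Y)"

text \<open>The orthogonal complement is taken inside the tangent space of the orthogonal group.\<close>

definition normal_space_Gr :: "nat \<Rightarrow> nat \<Rightarrow> real mat \<Rightarrow> real mat set" where
  "normal_space_Gr k n Q =
     {X \<in> tangent_O n Q. \<forall>Y \<in> tangent_space n (Gr k n) Q. metric_O Q X Y = 0}"

end

theory Submission
  imports Defs "Jordan_Normal_Form.Determinant"
begin

text \<open>
  If \<open>\<Lambda>\<^sub>1\<close> and \<open>\<Lambda>\<^sub>2\<close> are skew, then \<open>V diag(\<Lambda>\<^sub>1, \<Lambda>\<^sub>2) V\<^sup>T\<close> is skew, while every tangent vector of the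
  Grassmannian is symmetric, so the two are orthogonal.  Conversely, every tangent vector of the
  orthogonal group at \<open>Q\<close> is \<open>V I_sig L V\<^sup>T\<close> with \<open>L\<close> skew.  Rotating in the plane of coordinates
  \<open>i < k \<le> j\<close> shows that \<open>V (E\<^sub>i\<^sub>j + E\<^sub>j\<^sub>i) V\<^sup>T\<close> is tangent to the Grassmannian, and orthogonality to it
  reads \<open>2 L\<^sub>i\<^sub>j = 0\<close>, so the off-diagonal blocks of \<open>L\<close> vanish.
\<close>

section \<open>Traces, orthogonal matrices and skew matrices\<close>

lemma mtrace_mult:
  assumes "A \<in> carrier_mat n m" "B \<in> carrier_mat m n"
  shows "mtrace (A * B) = (\<Sum>i<n. \<Sum>j<m. A $$ (i, j) * B $$ (j, i))"
  using assms by (simp add: mtrace_def scalar_prod_def atLeast0LessThan)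

lemma mtrace_mult_commute:
  assumes "A \<in> carrier_mat n m" "B \<in> carrier_mat m n"
  shows "mtrace (A * B) = mtrace (B * A)"
  unfolding mtrace_mult[OF assms] mtrace_mult[OF assms(2,1)]
  by (subst sum.swap) (simp add: mult.commute)

lemma mtrace_add:
  assumes "A \<in> carrier_mat n n" "B \<in> carrier_mat n n"
  shows "mtrace (A + B) = mtrace A + mtrace B"
  using assms by (simp add: mtrace_def sum.distrib)

lemma mtrace_smult:
  assumes "A \<in> carrier_mat n n"
  shows "mtrace (c \<cdot>\<^sub>m A) = c * mtrace A"
  using assms by (simp add: mtrace_def sum_distrib_left)

lemma O_groupD:
  assumes "V \<in> O_group n"
  shows "V \<in> carrier_mat n n" "transpose_mat V \<in> carrier_mat n n"
    "transpose_mat V * V = 1\<^sub>m n" "V * transpose_mat V = 1\<^sub>m n"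
  using assms by (auto simp: O_group_def intro!: mat_mult_left_right_inverse)

lemma skew_matsI:
  assumes "L \<in> carrier_mat n n" "\<And>i j. i < n \<Longrightarrow> j < n \<Longrightarrow> L $$ (j, i) = - L $$ (i, j)"
  shows "L \<in> skew_mats n"
proof -
  have "transpose_mat L = - L"
  proof (rule eq_matI)
    fix i j assume "i < dim_row (- L)" "j < dim_col (- L)"
    then show "transpose_mat L $$ (i, j) = (- L) $$ (i, j)" using assms(1) assms(2)[of i j] by simp
  qed (use assms(1) in auto)
  with assms(1) show ?thesis by (simp add: skew_mats_def)
qed

lemma skew_matsD:
  assumes "L \<in> skew_mats n"
  shows "L \<in> carrier_mat n n" "transpose_mat L = - L"
    "\<And>i j. i < n \<Longrightarrow> j < n \<Longrightarrow> L $$ (j, i) = - L $$ (i, j)"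
proof -
  show L: "L \<in> carrier_mat n n" "transpose_mat L = - L"
    using assms by (auto simp: skew_mats_def)
  fix i j assume "i < n" "j < n"
  then have "transpose_mat L $$ (i, j) = (- L) $$ (i, j)" using L by simp
  then show "L $$ (j, i) = - L $$ (i, j)" using L(1) \<open>i < n\<close> \<open>j < n\<close> by simp
qed

text \<open>Exchanging the two indices changes the sign of the skew factor and keeps the symmetric
  one. The double sum that expresses the pairing is therefore its own negative.\<close>

lemma metric_O_skew_symmetric:
  assumes "X \<in> skew_mats n" "Y \<in> carrier_mat n n"
    and "\<And>i j. i < n \<Longrightarrow> j < n \<Longrightarrow> Y $$ (i, j) = Y $$ (j, i)"
  shows "metric_O Q X Y = 0"
proof -
  have X: "X \<in> carrier_mat n n" "transpose_mat X \<in> carrier_mat n n"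
    using skew_matsD[OF assms(1)] by auto
  have "metric_O Q X Y = (\<Sum>i<n. \<Sum>j<n. X $$ (j, i) * Y $$ (j, i))" (is "_ = ?s")
    unfolding metric_O_def mtrace_mult[OF X(2) assms(2)] using X by simp
  moreover have "?s = - ?s"
  proof -
    have swap: "X $$ (j, i) * Y $$ (j, i) = - (X $$ (i, j) * Y $$ (i, j))" if "i < n" "j < n" for i j
      using skew_matsD(3)[OF assms(1) that] assms(3)[OF that] by simp
    have "?s = (\<Sum>i<n. \<Sum>j<n. - (X $$ (i, j) * Y $$ (i, j)))"
      by (intro sum.cong refl swap) simp_all
    also have "\<dots> = - ?s"
      unfolding sum_negf by (subst sum.swap) simp
    finally show ?thesis .
  qed
  ultimately show ?thesis by simp
qed

section \<open>Tangent vectors and smooth curves\<close>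

lemma tangent_space_Gr_symmetric:
  assumes "Y \<in> tangent_space n (Gr k n) Q" "i < n" "j < n"
  shows "Y $$ (i, j) = Y $$ (j, i)"
proof -
  obtain \<gamma> \<epsilon> where e: "\<epsilon> > 0" and g: "\<And>t. t \<in> {-\<epsilon><..<\<epsilon>} \<Longrightarrow> \<gamma> t \<in> Gr k n"
    and d: "\<And>i j. i < n \<Longrightarrow> j < n \<Longrightarrow>
      ((\<lambda>t. \<gamma> t $$ (i, j)) has_real_derivative Y $$ (i, j)) (at 0)"
    using assms(1) unfolding tangent_space_def by blast
  have sym: "\<gamma> t $$ (i, j) = \<gamma> t $$ (j, i)" if "t \<in> {-\<epsilon><..<\<epsilon>}" for t
  proof -
    have "\<gamma> t \<in> carrier_mat n n" "transpose_mat (\<gamma> t) = \<gamma> t"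
      using g[OF that] by (auto simp: Gr_def O_group_def)
    then show ?thesis using assms(2,3) by (metis carrier_matD index_transpose_mat(1))
  qed
  \<comment> \<open>Both entry functions agree near 0, so the derivative of one is also a derivative
    of the other; uniqueness of derivatives then identifies the two entries of
    \<open>Y\<close>.\<close>
  have "((\<lambda>t. \<gamma> t $$ (i, j)) has_real_derivative Y $$ (j, i)) (at 0)"
    by (rule has_field_derivative_transform_within_open[OF d[OF assms(3,2)], of "{-\<epsilon><..<\<epsilon>}"])
      (use e sym in auto)
  with d[OF assms(2,3)] show ?thesis by (rule DERIV_unique)
qed

text \<open>The span of 1, cos and sin is closed under differentiation, so every iterated derivative
  has the same shape and is again differentiable.\<close>

lemma smooth_real_on_trig:
  "smooth_real_on S (\<lambda>t. a + b * cos t + c * sin t)"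
proof -
  have der: "((\<lambda>t. a + b * cos t + c * sin t) has_real_derivative c * cos t - b * sin t) (at t)"
    for a b c t :: real by (auto intro!: derivative_eq_intros)
  have "\<exists>a' b' c'. (deriv ^^ m) (\<lambda>t. a + b * cos t + c * sin t)
      = (\<lambda>t. a' + b' * cos t + c' * sin t)" for m
  proof (induction m)
    case 0
    show ?case by auto
  next
    case (Suc m)
    then obtain a' b' c' where
      "(deriv ^^ m) (\<lambda>t. a + b * cos t + c * sin t) = (\<lambda>t. a' + b' * cos t + c' * sin t)" by blast
    then have "(deriv ^^ Suc m) (\<lambda>t. a + b * cos t + c * sin t)
        = (\<lambda>t. 0 + c' * cos t + (- b') * sin t)"
      using DERIV_imp_deriv[OF der] by auto
    then show ?case by blast
  qed
  then show ?thesis unfolding smooth_real_on_def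
    by (metis der field_differentiable_def)
qed

section \<open>A curve of reflections through \<open>I_sig k (n - k)\<close>\<close>

lemma I_sig_carrier: "k \<le> n \<Longrightarrow> I_sig k (n - k) \<in> carrier_mat n n"
  by (auto simp: I_sig_def block_diag_def)

lemma I_sig_index:
  assumes "i < n" "j < n" "k \<le> n"
  shows "I_sig k (n - k) $$ (i, j) = (if i = j then if i < k then 1 else - 1 else 0)"
  using assms by (auto simp: I_sig_def block_diag_def)

text \<open>In matrix units this is E_ii - E_jj, the direction in which the diagonal of the curve
  below moves.\<close>

definition diag_diff :: "nat \<Rightarrow> nat \<Rightarrow> nat \<Rightarrow> real mat" where
  "diag_diff n i j = mat n n (\<lambda>(a, b). if a = b then of_bool (a = i) - of_bool (a = j) else 0)"

text \<open>For distinct \<open>i\<close> and \<open>j\<close> this is E_ij + E_ji, the initial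
  velocity of the curve below.\<close>

definition sym_unit :: "nat \<Rightarrow> nat \<Rightarrow> nat \<Rightarrow> real mat" where
  "sym_unit n i j = mat n n (\<lambda>(a, b). of_bool (a = i \<and> b = j) + of_bool (a = j \<and> b = i))"

text \<open>
  Conjugating \<open>I_sig k (n - k)\<close> by the rotation through \<open>t / 2\<close> in the plane of the \<open>i\<close>-th and
  \<open>j\<close>-th coordinates, where \<open>i < k \<le> j\<close>, gives the following curve.
\<close>

definition reflection_curve :: "nat \<Rightarrow> nat \<Rightarrow> nat \<Rightarrow> nat \<Rightarrow> real \<Rightarrow> real mat" where
  "reflection_curve k n i j t =
     I_sig k (n - k) + ((cos t - 1) \<cdot>\<^sub>m diag_diff n i j + sin t \<cdot>\<^sub>m sym_unit n i j)"

lemma diag_diff_carrier: "diag_diff n i j \<in> carrier_mat n n"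
  by (simp add: diag_diff_def)

lemma sym_unit_carrier: "sym_unit n i j \<in> carrier_mat n n"
  by (simp add: sym_unit_def)

lemma reflection_curve_carrier:
  "k \<le> n \<Longrightarrow> reflection_curve k n i j t \<in> carrier_mat n n"
  using diag_diff_carrier[of n i j] sym_unit_carrier[of n i j] I_sig_carrier[of k n]
  by (auto simp: reflection_curve_def)

lemma mtrace_mult_sym_unit:
  assumes "A \<in> carrier_mat n n" "i < n" "j < n"
  shows "mtrace (A * sym_unit n i j) = A $$ (i, j) + A $$ (j, i)"
proof -
  have "mtrace (A * sym_unit n i j) =
    (\<Sum>a<n. \<Sum>b<n. A $$ (a, b) * (of_bool (b = i \<and> a = j) + of_bool (b = j \<and> a = i)))"
    unfolding mtrace_mult[OF assms(1) sym_unit_carrier] by (simp add: sym_unit_def)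
  \<comment> \<open>Splitting the two indicators into nested conditionals lets each double sum
    collapse to one term.\<close>
  also have "\<dots> = (\<Sum>a<n. \<Sum>b<n. if b = i then if a = j then A $$ (a, b) else 0 else 0)
      + (\<Sum>a<n. \<Sum>b<n. if b = j then if a = i then A $$ (a, b) else 0 else 0)"
    unfolding sum.distrib[symmetric] by (intro sum.cong refl) auto
  also have "\<dots> = A $$ (i, j) + A $$ (j, i)"
    using assms by (simp add: sum.delta)
  finally show ?thesis .
qed

text \<open>The signature has 1 at \<open>i\<close> and -1 at \<open>j\<close>, so adding cos t - 1
  times \<open>diag_diff\<close> turns these into cos t and -cos t. The off-diagonal part is kept as
  separate conditionals on the column so that sums over columns collapse.\<close>

lemma reflection_curve_index:
  assumes "a < n" "b < n" "k \<le> n" "i < k" "k \<le> j"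
  shows "reflection_curve k n i j t $$ (a, b) =
    (if a = b then if a = i then cos t else if a = j then - cos t else if a < k then 1 else - 1
     else 0) + (if b = j then if a = i then sin t else 0 else 0)
     + (if b = i then if a = j then sin t else 0 else 0)"
  using assms I_sig_carrier[of k n]
  by (auto simp: reflection_curve_def diag_diff_def sym_unit_def I_sig_index)

text \<open>In the plane of \<open>i\<close> and \<open>j\<close> the matrix is the planar
  reflection with rows (cos t, sin t) and (sin t, -cos t); elsewhere it is diagonal with entries 1
  or -1. It is thus a symmetric involution. The trace of the signature matrix is a hypothesis
  because it is later read off from a given point of the Grassmannian.\<close>

lemma reflection_curve_Gr:
  assumes "k \<le> n" "i < k" "k \<le> j" "j < n"
    and "mtrace (I_sig k (n - k)) = 2 * real k - real n"
  shows "reflection_curve k n i j t \<in> Gr k n"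
proof -
  let ?R = "reflection_curve k n i j t"
  note R = reflection_curve_carrier[OF assms(1), of i j t]
  note ix = reflection_curve_index[OF _ _ assms(1-3)]
  have "i \<noteq> j" using assms by simp
  have sym: "transpose_mat ?R = ?R"
    by (rule eq_matI) (use R in \<open>auto simp: ix\<close>)
  have "?R * ?R = 1\<^sub>m n"
  proof (rule eq_matI)
    fix a b assume "a < dim_row (1\<^sub>m n :: real mat)" "b < dim_col (1\<^sub>m n :: real mat)"
    then have ab: "a < n" "b < n" by auto
    define u where "u = (if a = i then cos t else if a = j then - cos t else if a < k then 1 else - 1)"
    have "(?R * ?R) $$ (a, b) = (\<Sum>l<n. ?R $$ (a, l) * ?R $$ (l, b))"
      using R ab by (simp add: scalar_prod_def atLeast0LessThan)
    \<comment> \<open>A row has at most two nonzero entries: the diagonal one, \<open>u\<close>, and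
      sin t in the partner column when the row is \<open>i\<close> or \<open>j\<close>.\<close>
    also have "\<dots> = (\<Sum>l<n. (if a = l then u * ?R $$ (l, b) else 0)
        + (if l = j then if a = i then sin t * ?R $$ (l, b) else 0 else 0)
        + (if l = i then if a = j then sin t * ?R $$ (l, b) else 0 else 0))"
      using ab by (intro sum.cong refl) (auto simp: ix[of a] u_def algebra_simps)
    also have "\<dots> = u * ?R $$ (a, b) + (if a = i then sin t * ?R $$ (j, b) else 0)
        + (if a = j then sin t * ?R $$ (i, b) else 0)"
      using ab assms by (simp add: sum.distrib)
    \<comment> \<open>The diagonal needs cos^2 + sin^2 = 1; off it, the products of sin t and cos t
      cancel because the diagonal entries at \<open>i\<close> and \<open>j\<close> are
      opposite.\<close>
    also have "\<dots> = 1\<^sub>m n $$ (a, b)"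
      using ab assms sin_cos_squared_add3[of t] by (auto simp: ix u_def algebra_simps)
    finally show "(?R * ?R) $$ (a, b) = 1\<^sub>m n $$ (a, b)" .
  qed (use R in auto)
  moreover have "mtrace (diag_diff n i j) = 0" "mtrace (sym_unit n i j) = 0"
    using assms \<open>i \<noteq> j\<close> by (simp_all add: mtrace_def diag_diff_def sym_unit_def sum_subtractf of_bool_def cong: conj_cong)
  then have "mtrace ?R = 2 * real k - real n"
    unfolding reflection_curve_def
    using assms(1,5) I_sig_carrier[OF assms(1)] diag_diff_carrier[of n i j] sym_unit_carrier[of n i j]
    by (simp add: mtrace_add[where n=n] mtrace_smult[where n=n])
  ultimately show ?thesis using R sym by (simp add: Gr_def O_group_def)
qed

section \<open>Conjugation by an orthogonal matrix\<close>

lemma mult_conj: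
  assumes V: "V \<in> O_group n" and A: "A \<in> carrier_mat n n" and B: "B \<in> carrier_mat n n"
  shows "(V * A * transpose_mat V) * (V * B * transpose_mat V) = V * (A * B) * transpose_mat V"
proof -
  note V = O_groupD[OF V]
  have "(V * A * transpose_mat V) * (V * B * transpose_mat V)
      = V * A * (transpose_mat V * V) * (B * transpose_mat V)"
    using V(1,2) A B by (simp add: assoc_mult_mat[where n\<^sub>1=n and n\<^sub>2=n and n\<^sub>3=n and n\<^sub>4=n])
  also have "\<dots> = V * (A * B) * transpose_mat V"
    unfolding V(3)
    using V(1,2) A B by (simp add: assoc_mult_mat[where n\<^sub>1=n and n\<^sub>2=n and n\<^sub>3=n and n\<^sub>4=n])
  finally show ?thesis .
qed

lemma transpose_conj:
  fixes V A :: "'a :: comm_semiring_0 mat"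
  assumes V: "V \<in> carrier_mat n n" and A: "A \<in> carrier_mat n n"
  shows "transpose_mat (V * A * transpose_mat V) = V * transpose_mat A * transpose_mat V"
proof -
  have "transpose_mat (V * A * transpose_mat V) = V * transpose_mat (V * A)"
    using V A transpose_mult[of "V * A" n n "transpose_mat V" n] by (simp del: assoc_mult_mat)
  also have "transpose_mat (V * A) = transpose_mat A * transpose_mat V"
    using V A by (rule transpose_mult)
  finally show ?thesis
    using V A by (simp add: assoc_mult_mat[where n\<^sub>1=n and n\<^sub>2=n and n\<^sub>3=n and n\<^sub>4=n])
qed

lemma mtrace_conj:
  assumes V: "V \<in> O_group n" and A: "A \<in> carrier_mat n n"
  shows "mtrace (V * A * transpose_mat V) = mtrace A"
proof -
  note V = O_groupD[OF V]
  have "mtrace (V * A * transpose_mat V) = mtrace (transpose_mat V * (V * A))"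
    using V A by (intro mtrace_mult_commute) auto
  also have "transpose_mat V * (V * A) = A"
    using V A assoc_mult_mat[OF V(2,1) A] by simp
  finally show ?thesis .
qed

lemma skew_conj:
  assumes "V \<in> carrier_mat n n" "L \<in> skew_mats n"
  shows "V * L * transpose_mat V \<in> skew_mats n"
proof -
  have "V * L * transpose_mat V \<in> carrier_mat n n"
    using assms(1) skew_matsD(1)[OF assms(2)] by auto
  then show ?thesis
    using assms(1) skew_matsD(1,2)[OF assms(2)]
    by (simp add: skew_mats_def transpose_conj[where n=n] del: assoc_mult_mat)
qed

lemma Gr_conj:
  assumes V: "V \<in> O_group n" and R: "R \<in> Gr k n"
  shows "V * R * transpose_mat V \<in> Gr k n"
proof -
  have R: "R \<in> carrier_mat n n" "transpose_mat R = R" "R * R = 1\<^sub>m n"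
    "mtrace R = 2 * real k - real n"
    using R by (auto simp: Gr_def O_group_def)
  show ?thesis
    using O_groupD[OF V] R mult_conj[OF V R(1,1)] mtrace_conj[OF V R(1)]
      transpose_conj[OF O_groupD(1)[OF V] R(1)]
    by (simp add: Gr_def O_group_def)
qed

text \<open>The witness is the conjugated reflection curve: it stays in the Grassmannian, and its
  velocity at 0 is the coefficient of sin t.\<close>

lemma conj_sym_unit_tangent:
  assumes V: "V \<in> O_group n" and ij: "k \<le> n" "i < k" "k \<le> j" "j < n"
    and Q: "V * I_sig k (n - k) * transpose_mat V \<in> Gr k n" (is "?Q \<in> _")
  shows "V * sym_unit n i j * transpose_mat V \<in> tangent_space n (Gr k n) ?Q"
proof -
  let ?c = "\<lambda>A. V * A * transpose_mat V"
  let ?g = "\<lambda>t. ?c (reflection_curve k n i j t)"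
  note VV = O_groupD[OF V]
  note car = VV(1,2) I_sig_carrier[OF ij(1)] diag_diff_carrier[of n i j] sym_unit_carrier[of n i j]
  have tr: "mtrace (I_sig k (n - k)) = 2 * real k - real n"
    using Q mtrace_conj[OF V car(3)] by (simp add: Gr_def)
  have G: "?g t \<in> Gr k n" for t
    by (rule Gr_conj[OF V reflection_curve_Gr[OF ij tr]])
  have "?g t = ?Q + ((cos t - 1) \<cdot>\<^sub>m ?c (diag_diff n i j) + sin t \<cdot>\<^sub>m ?c (sym_unit n i j))" for t
    using car unfolding reflection_curve_def
    by (simp add: mult_add_distrib_mat[where nr=n and n=n and nc=n]
        add_mult_distrib_mat[where nr=n and n=n and nc=n]
        mult_smult_distrib[where nr=n and n=n and nc=n]
        mult_smult_assoc_mat[where nr=n and n=n and nc=n])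
  \<comment> \<open>Collecting terms puts each entry into the form handled by
    \<open>smooth_real_on_trig\<close>.\<close>
  then have entry: "?g t $$ (a, b) = (?Q $$ (a, b) - ?c (diag_diff n i j) $$ (a, b))
      + ?c (diag_diff n i j) $$ (a, b) * cos t + ?c (sym_unit n i j) $$ (a, b) * sin t"
    if "a < n" "b < n" for a b t
    using that car by (simp add: algebra_simps del: index_mult_mat(1))
  have zero: "?g 0 = ?Q"
    using car by (intro arg_cong[where f="?c"] eq_matI) (auto simp: reflection_curve_def)
  have der: "((\<lambda>t. p + q * cos t + r * sin t) has_real_derivative r) (at 0)" for p q r :: real
    by (auto intro!: derivative_eq_intros)
  \<comment> \<open>The curve lies in the Grassmannian for all times, so the radius 1 is an
    arbitrary choice.\<close>
  have "smooth_real_on {-1<..<1} (\<lambda>t. ?g t $$ (a, b)) \<and>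
      ((\<lambda>t. ?g t $$ (a, b)) has_real_derivative ?c (sym_unit n i j) $$ (a, b)) (at 0)"
    if "a < n" "b < n" for a b
    unfolding entry[OF that]
    by (rule conjI[OF smooth_real_on_trig der])
  moreover have C: "?c (sym_unit n i j) \<in> carrier_mat n n"
    using car by auto
  ultimately show ?thesis
    unfolding tangent_space_def using G zero C
    by (intro CollectI conjI exI[of _ ?g] exI[of _ "1::real"] ballI allI impI) simp_all
qed

section \<open>Block diagonal matrices and the signature matrix\<close>

lemma block_diag_skew:
  assumes "A \<in> skew_mats k" "B \<in> skew_mats l"
  shows "block_diag A B \<in> skew_mats (k + l)"
proof (rule skew_matsI)
  note AB = skew_matsD(1)[OF assms(1)] skew_matsD(1)[OF assms(2)]
  then show "block_diag A B \<in> carrier_mat (k + l) (k + l)" by (auto simp: block_diag_def)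
  fix i j assume "i < k + l" "j < k + l"
  then show "block_diag A B $$ (j, i) = - block_diag A B $$ (i, j)"
    using AB skew_matsD(3)[OF assms(1), of i j] skew_matsD(3)[OF assms(2), of "i - k" "j - k"]
    by (auto simp: block_diag_def)
qed

lemma uminus_skew:
  assumes "A \<in> skew_mats n"
  shows "- A \<in> skew_mats n"
  using skew_matsD(1,2)[OF assms] by (simp add: skew_mats_def transpose_uminus)

lemma I_sig_mult_index:
  assumes "k \<le> n" "A \<in> carrier_mat n n" "i < n" "j < n"
  shows "(I_sig k (n - k) * A) $$ (i, j) = (if i < k then A $$ (i, j) else - A $$ (i, j))"
  using assms I_sig_carrier[OF assms(1)]
  by (simp add: scalar_prod_def I_sig_index if_distrib[of "\<lambda>x. x * _"] sum.delta cong: if_cong)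

text \<open>Only the rows from \<open>k\<close> on change sign, and these meet only the lower block.
  This links the form \<open>Q * L\<close> of tangent vectors of the orthogonal group to the block
  form of normal vectors.\<close>

lemma I_sig_mult_block_diag:
  assumes "k \<le> n" "A \<in> skew_mats k" "B \<in> skew_mats (n - k)"
  shows "I_sig k (n - k) * block_diag A B = block_diag A (- B)"
proof (rule eq_matI)
  note AB = skew_matsD(1)[OF assms(2)] skew_matsD(1)[OF assms(3)]
  have D: "block_diag A B \<in> carrier_mat n n"
    using AB assms(1) by (auto simp: block_diag_def)
  fix i j assume "i < dim_row (block_diag A (- B))" "j < dim_col (block_diag A (- B))"
  then have "i < n" "j < n" using AB assms(1) by (auto simp: block_diag_def)
  then show "(I_sig k (n - k) * block_diag A B) $$ (i, j) = block_diag A (- B) $$ (i, j)"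
    unfolding I_sig_mult_index[OF assms(1) D \<open>i < n\<close> \<open>j < n\<close>]
    using AB assms(1) by (auto simp: block_diag_def)
qed (use skew_matsD(1)[OF assms(2)] skew_matsD(1)[OF assms(3)] I_sig_carrier[OF assms(1)] assms(1)
  in \<open>auto simp: block_diag_def\<close>)

section \<open>The two inclusions for the normal space\<close>

theorem proposition3p6:
  fixes k n :: nat and Q V :: "real mat"
  assumes "1 \<le> k" and "k \<le> n"
    and "Q \<in> Gr k n"
    and "V \<in> O_group n"
    and "Q = V * I_sig k (n - k) * transpose_mat V"
  shows "normal_space_Gr k n Q =
    {V * block_diag \<Lambda>\<^sub>1 \<Lambda>\<^sub>2 * transpose_mat V |\<Lambda>\<^sub>1 \<Lambda>\<^sub>2.
       \<Lambda>\<^sub>1 \<in> skew_mats k \<and> \<Lambda>\<^sub>2 \<in> skew_mats (n - k)}"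
proof (intro equalityI subsetI)
  note V = O_groupD[OF assms(4)] and I = I_sig_carrier[OF assms(2)]
  fix X assume X: "X \<in> normal_space_Gr k n Q"
  then obtain L0 where L0: "L0 \<in> skew_mats n" "X = Q * L0"
    by (auto simp: normal_space_Gr_def tangent_O_def)
  \<comment> \<open>\<open>L\<close> is \<open>L0\<close> in the coordinates given by
    \<open>V\<close>, in which \<open>Q\<close> becomes the signature matrix.\<close>
  define L where "L = transpose_mat V * L0 * V"
  have L: "L \<in> skew_mats n"
    using skew_conj[OF V(2) L0(1)] by (simp add: L_def)
  note L' = skew_matsD[OF L]
  have "V * L * transpose_mat V = (V * transpose_mat V) * L0 * (V * transpose_mat V)"
    unfolding L_def using V(1,2) skew_matsD(1)[OF L0(1)]
    by (simp add: assoc_mult_mat[where n\<^sub>1=n and n\<^sub>2=n and n\<^sub>3=n and n\<^sub>4=n])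
  then have "L0 = V * L * transpose_mat V" using V skew_matsD(1)[OF L0(1)] by simp
  then have XL: "X = V * (I_sig k (n - k) * L) * transpose_mat V"
    using mult_conj[OF assms(4) I L'(1)] L0(2) assms(5) by simp
  define W where "W = I_sig k (n - k) * L"
  have W: "W \<in> carrier_mat n n" using I L' by (simp add: W_def)
  have W_index: "W $$ (i, j) = (if i < k then L $$ (i, j) else - L $$ (i, j))"
    if "i < n" "j < n" for i j
    unfolding W_def by (rule I_sig_mult_index[OF assms(2) L'(1) that])
  have zero: "L $$ (i, j) = 0" if "i < k" "k \<le> j" "j < n" for i j
  proof -
    have T: "V * sym_unit n i j * transpose_mat V \<in> tangent_space n (Gr k n) Q"
      using conj_sym_unit_tangent[OF assms(4,2) that] assms(3,5) by simp
    have "0 = metric_O Q X (V * sym_unit n i j * transpose_mat V)"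
      using X T by (simp add: normal_space_Gr_def)
    \<comment> \<open>Conjugation by \<open>V\<close> passes through transpose and product, so the
      pairing can be computed in the coordinates of \<open>V\<close>.\<close>
    also have "\<dots> = mtrace (V * (transpose_mat W * sym_unit n i j) * transpose_mat V)"
      using W by (simp add: metric_O_def XL W_def[symmetric] transpose_conj[OF V(1)]
          mult_conj[OF assms(4) _ sym_unit_carrier])
    also have "\<dots> = mtrace (transpose_mat W * sym_unit n i j)"
      using W sym_unit_carrier[of n i j] by (intro mtrace_conj[OF assms(4)]) simp
    also have "\<dots> = W $$ (j, i) + W $$ (i, j)"
      using W that assms(2) by (subst mtrace_mult_sym_unit) auto
    \<comment> \<open>The sign of the signature in row \<open>j\<close> undoes the sign from
      skewness, so the two entries add up instead of cancelling.\<close>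
    also have "\<dots> = 2 * L $$ (i, j)"
      using that assms(2) L'(3)[of i j] by (simp add: W_index)
    finally show ?thesis by simp
  qed
  have zero': "L $$ (i, j) = 0" if "j < k" "k \<le> i" "i < n" for i j
    using zero[OF that] L'(3)[of i j] that assms(2) by simp
  define A where "A = mat k k (\<lambda>(i, j). L $$ (i, j))"
  \<comment> \<open>The minus sign is that of the signature on the rows from \<open>k\<close> on,
    since the blocks describe \<open>W\<close> and not \<open>L\<close>.\<close>
  define B where "B = mat (n - k) (n - k) (\<lambda>(i, j). - L $$ (i + k, j + k))"
  have "A \<in> skew_mats k"
  proof (rule skew_matsI)
    fix i j assume "i < k" "j < k"
    then show "A $$ (j, i) = - A $$ (i, j)" using assms(2) L'(3)[of i j] by (simp add: A_def)
  qed (simp add: A_def)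
  moreover have "B \<in> skew_mats (n - k)"
  proof (rule skew_matsI)
    fix i j assume "i < n - k" "j < n - k"
    then show "B $$ (j, i) = - B $$ (i, j)"
      using assms(2) L'(3)[of "i + k" "j + k"] by (simp add: B_def)
  qed (simp add: B_def)
  moreover have "W = block_diag A B"
    using W assms(2) zero zero'
    by (intro eq_matI) (auto simp: W_index A_def B_def block_diag_def)
  moreover have "X = V * W * transpose_mat V" using XL by (simp only: W_def)
  ultimately show "X \<in> {V * block_diag \<Lambda>\<^sub>1 \<Lambda>\<^sub>2 * transpose_mat V |\<Lambda>\<^sub>1 \<Lambda>\<^sub>2.
       \<Lambda>\<^sub>1 \<in> skew_mats k \<and> \<Lambda>\<^sub>2 \<in> skew_mats (n - k)}"
    by blast
next
  note V = O_groupD[OF assms(4)] and I = I_sig_carrier[OF assms(2)]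
  fix X assume "X \<in> {V * block_diag \<Lambda>\<^sub>1 \<Lambda>\<^sub>2 * transpose_mat V |\<Lambda>\<^sub>1 \<Lambda>\<^sub>2.
       \<Lambda>\<^sub>1 \<in> skew_mats k \<and> \<Lambda>\<^sub>2 \<in> skew_mats (n - k)}"
  then obtain A B where AB: "A \<in> skew_mats k" "B \<in> skew_mats (n - k)"
    and X: "X = V * block_diag A B * transpose_mat V" by blast
  note mB = uminus_skew[OF AB(2)]
  have D: "block_diag A B \<in> skew_mats n" "block_diag A (- B) \<in> skew_mats n"
    using block_diag_skew[OF AB(1) AB(2)] block_diag_skew[OF AB(1) mB] assms(2) by simp_all
  \<comment> \<open>The lower block of the skew factor is \<open>- B\<close> because multiplication
    by the signature matrix negates it once more and restores \<open>B\<close>.\<close>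
  have "X = Q * (V * block_diag A (- B) * transpose_mat V)"
    unfolding X assms(5) mult_conj[OF assms(4) I skew_matsD(1)[OF D(2)]]
      I_sig_mult_block_diag[OF assms(2) AB(1) mB] by simp
  then have "X \<in> tangent_O n Q"
    unfolding tangent_O_def using skew_conj[OF V(1) D(2)] by blast
  \<comment> \<open>\<open>X\<close> is itself skew, being a conjugate of a skew block matrix, while
    \<open>Y\<close> is symmetric.\<close>
  moreover have "metric_O Q X Y = 0" if "Y \<in> tangent_space n (Gr k n) Q" for Y
    using that skew_conj[OF V(1) D(1)] unfolding X
    by (intro metric_O_skew_symmetric[where n=n] tangent_space_Gr_symmetric[OF that])
      (auto simp: tangent_space_def)
  ultimately show "X \<in> normal_space_Gr k n Q" by (simp add: normal_space_Gr_def)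
qed

end
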